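(* Suppose that the following statement holds: for every integer $p\ge 1$, every graph $G$ on $n$ vertices with at least $(p-2)n-\binom{p-1}{2}+1$ edges either has a $K_p$ minor or is $(p-1)$-colorable. Then for every integer $p\ge 5$, every graph with no $K_p$ minor is $(2p-6)$-colorable.
   Context: All graphs are finite and simple. A graph $H$ is a minor of $G$ if $H$ can be obtained from a subgraph of $G$ by contracting edges. A graph is $c$-colorable if it has a proper vertex coloring with at most $c$ colors. *)

theory Defs
  imports Main
begin

record 'a ugraph =
  verts :: "'a set"
  edges :: "'a set set"

definition simple_graph :: "'a ugraph \<Rightarrow> bool" where
  "simple_graph G \<longleftrightarrow>
     finite (verts G) \<and> (\<forall>e\<in>edges G. e \<subseteq> verts G \<and> card e = 2)"

definition subgraph :: "'a ugraph \<Rightarrow> 'a ugraph \<Rightarrow> bool" where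
  "subgraph H G \<longleftrightarrow> simple_graph H \<and> verts H \<subseteq> verts G \<and> edges H \<subseteq> edges G"

(* The vertex v is merged into u. Parallel edges are identified because edges form a set;
   the condition on the cardinality removes the loop arising from the edge {u, v}. *)
definition contract :: "'a \<Rightarrow> 'a \<Rightarrow> 'a ugraph \<Rightarrow> 'a ugraph" where
  "contract u v G =
     \<lparr>verts = verts G - {v},
      edges = {e' \<in> (\<lambda>e. id(v := u) ` e) ` edges G. card e' = 2}\<rparr>"

definition edge_contraction :: "'a ugraph \<Rightarrow> 'a ugraph \<Rightarrow> bool" where
  "edge_contraction G G' \<longleftrightarrow> (\<exists>u v. {u, v} \<in> edges G \<and> G' = contract u v G)"

definition isomorphic :: "'a ugraph \<Rightarrow> 'b ugraph \<Rightarrow> bool" where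
  "isomorphic G H \<longleftrightarrow>
     (\<exists>f. bij_betw f (verts G) (verts H) \<and>
          (\<forall>u\<in>verts G. \<forall>v\<in>verts G. {u, v} \<in> edges G \<longleftrightarrow> {f u, f v} \<in> edges H))"

definition minor :: "'b ugraph \<Rightarrow> 'a ugraph \<Rightarrow> bool" where
  "minor H G \<longleftrightarrow>
     (\<exists>S M. subgraph S G \<and> edge_contraction\<^sup>*\<^sup>* S M \<and> isomorphic M H)"

definition complete_graph :: "nat \<Rightarrow> nat ugraph" where
  "complete_graph p = \<lparr>verts = {..<p}, edges = {e. e \<subseteq> {..<p} \<and> card e = 2}\<rparr>"

definition colorable :: "nat \<Rightarrow> 'a ugraph \<Rightarrow> bool" where
  "colorable c G \<longleftrightarrow>
     (\<exists>f :: 'a \<Rightarrow> nat. (\<forall>v\<in>verts G. f v < c) \<and>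
        (\<forall>u v. {u, v} \<in> edges G \<longrightarrow> f u \<noteq> f v))"

end

theory Submission
  imports Defs "HOL-Library.FuncSet"
begin

text \<open>
  The hypothesis already implies Hadwiger's bound: every graph without a $K_p$ minor is
  $(p-1)$-colorable, and $p - 1 \<le> 2p - 6$ for $p \<ge> 5$. The point is that the hypothesis
  constrains only the global edge density, while random graphs with no $K_q$ minor can have average
  degree greater than $2(q-2)$ once $q$ is large. Fix one such graph $F$. If $G$ has no $K_p$ minor and
  is not $(p-1)$-colorable, then the disjoint union of $G + K_q$ with $(tF) + K_p$ (joins; $tF$ denotes
  $t$ disjoint copies of $F$) has no $K_{p+q}$ minor and is not $(p+q-1)$-colorable, but for large $t$ it
  has more edges than the hypothesis permits.
\<close>

section \<open>Branch sets\<close>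

text \<open>The joins bring the two summands to the same threshold. A vertex joined to everything
  meets at most one branch set and needs a colour of its own, so each such vertex raises the
  excluded clique order and the required number of colours by one. A clique minor of the union is
  connected and stays in one summand, and a colouring restricts to either summand. One summand thus
  supplies the chromatic obstruction and the other the edges: each copy of \<open>F\<close> is at
  least one edge above its allowance, and a surplus linear in \<open>t\<close> outgrows every fixed
  cost.

  Why \<open>F\<close> exists: a uniform graph on \<open>n = 8r\<close> vertices has about
  \<open>n^2/4 = 2rn\<close> edges, so \<open>q = 2r\<close> is just small enough for it to be
  dense. A fixed labelling survives with probability exponentially small in \<open>r^2\<close>,
  while there are only \<open>(2r+1)^(8r)\<close> labellings. A count of this kind needs a finite
  family of witnesses, so contraction sequences are first replaced by labellings.\<close>

definition connected_in :: "'a set set \<Rightarrow> 'a set \<Rightarrow> bool" where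
  "connected_in E B \<longleftrightarrow> (\<forall>A. A \<subset> B \<and> A \<noteq> {} \<longrightarrow> (\<exists>a\<in>A. \<exists>b\<in>B - A. {a, b} \<in> E))"

definition fibre :: "'a ugraph \<Rightarrow> ('a \<Rightarrow> nat) \<Rightarrow> nat \<Rightarrow> 'a set" where
  "fibre G f i = {v \<in> verts G. f v = i}"

text \<open>
  The fibres over the labels below \<open>q\<close> are the branch sets of a \<open>K\<^sub>q\<close> minor;
  vertices with other labels are deleted.
\<close>

definition clique_labelling :: "nat \<Rightarrow> 'a ugraph \<Rightarrow> ('a \<Rightarrow> nat) \<Rightarrow> bool" where
  "clique_labelling q G f \<longleftrightarrow>
     (\<forall>i<q. fibre G f i \<noteq> {} \<and> connected_in (edges G) (fibre G f i)) \<and>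
     (\<forall>i<q. \<forall>j<q. i \<noteq> j \<longrightarrow> (\<exists>a\<in>fibre G f i. \<exists>b\<in>fibre G f j. {a, b} \<in> edges G))"

lemma connected_inD:
  assumes "connected_in E B" "A \<subset> B" "A \<noteq> {}"
  shows "\<exists>a\<in>A. \<exists>b\<in>B - A. {a, b} \<in> E"
  using assms unfolding connected_in_def by simp

lemma clique_labellingD:
  assumes "clique_labelling q G f" "i < q"
  shows "fibre G f i \<noteq> {}" "connected_in (edges G) (fibre G f i)"
  using assms unfolding clique_labelling_def by simp_all

lemma clique_labelling_adjE:
  assumes "clique_labelling q G f" "i < q" "j < q" "i \<noteq> j"
  obtains a b where "a \<in> fibre G f i" "b \<in> fibre G f j" "{a, b} \<in> edges G"
  using assms unfolding clique_labelling_def by meson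

text \<open>Common tool for discarding vertices or branch sets: those of \<open>g\<close> are a
  selection, indexed by \<open>\<sigma>\<close>, of those of \<open>f\<close>, and both clauses of
  the definition mention only edges between selected vertices.\<close>

lemma clique_labelling_transfer:
  assumes lab: "clique_labelling q' G' f"
    and \<sigma>: "inj_on \<sigma> {..<q}" "\<And>i. i < q \<Longrightarrow> \<sigma> i < q'"
    and fib: "\<And>i. i < q \<Longrightarrow> fibre G g i = fibre G' f (\<sigma> i)"
    and edge: "\<And>i j a b. i < q \<Longrightarrow> j < q \<Longrightarrow> a \<in> fibre G g i \<Longrightarrow> b \<in> fibre G g j \<Longrightarrow>
      {a, b} \<in> edges G' \<Longrightarrow> {a, b} \<in> edges G"
  shows "clique_labelling q G g"
proof -
  have "connected_in (edges G) (fibre G g i)" if iq: "i < q" for i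
    unfolding connected_in_def
  proof (intro allI impI, elim conjE)
    fix A assume A: "A \<subset> fibre G g i" "A \<noteq> {}"
    then obtain a b where "a \<in> A" "b \<in> fibre G g i - A" "{a, b} \<in> edges G'"
      using connected_inD[OF clique_labellingD(2)[OF lab \<sigma>(2)[OF iq]], of A] fib[OF iq] by auto
    then show "\<exists>a\<in>A. \<exists>b\<in>fibre G g i - A. {a, b} \<in> edges G"
      using edge[OF iq iq, of a b] A by blast
  qed
  moreover have "\<exists>a\<in>fibre G g i. \<exists>b\<in>fibre G g j. {a, b} \<in> edges G" if ij: "i < q" "j < q" "i \<noteq> j" for i j
  proof -
    have "\<sigma> i \<noteq> \<sigma> j" using \<sigma>(1) ij unfolding inj_on_def by auto
    then obtain a b where "a \<in> fibre G' f (\<sigma> i)" "b \<in> fibre G' f (\<sigma> j)" "{a, b} \<in> edges G'"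
      using clique_labelling_adjE[OF lab \<sigma>(2)[OF ij(1)] \<sigma>(2)[OF ij(2)]] by blast
    then show ?thesis using edge[OF ij(1,2), of a b] fib ij by auto
  qed
  moreover have "fibre G g i \<noteq> {}" if "i < q" for i
    using clique_labellingD(1)[OF lab \<sigma>(2)] fib that by simp
  ultimately show ?thesis unfolding clique_labelling_def by simp
qed

lemma simple_edgeD:
  assumes "simple_graph G" "{a, b} \<in> edges G"
  shows "a \<in> verts G" "b \<in> verts G" "a \<noteq> b"
proof -
  have "{a, b} \<subseteq> verts G" "card {a, b} = 2"
    using assms unfolding simple_graph_def by blast+
  then show "a \<in> verts G" "b \<in> verts G" "a \<noteq> b" by auto
qed

lemma simple_edgeE:
  assumes "simple_graph G" "e \<in> edges G"
  obtains a b where "e = {a, b}" "a \<noteq> b" "a \<in> verts G" "b \<in> verts G"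
proof -
  have "e \<subseteq> verts G" "card e = 2"
    using assms unfolding simple_graph_def by blast+
  then show thesis using that by (auto simp: card_2_iff)
qed

lemma finite_edges:
  assumes "simple_graph G"
  shows "finite (edges G)"
  by (rule finite_subset[of _ "Pow (verts G)"]) (use assms in \<open>auto simp: simple_graph_def\<close>)

lemma contract_edgeI:
  assumes "{a, b} \<in> edges G" "(id(v := u)) a \<noteq> (id(v := u)) b"
  shows "{(id(v := u)) a, (id(v := u)) b} \<in> edges (contract u v G)"
proof -
  have "id(v := u) ` {a, b} = {(id(v := u)) a, (id(v := u)) b}" by blast
  moreover have "card {(id(v := u)) a, (id(v := u)) b} = 2" using assms(2) by (simp only: card_2_iff) blast
  ultimately show ?thesis using assms(1) unfolding contract_def by (simp only: ugraph.simps) blast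
qed

lemma contract_edgeE:
  assumes "simple_graph G" "{a', b'} \<in> edges (contract u v G)"
  obtains a b where "{a, b} \<in> edges G" "(id(v := u)) a = a'" "(id(v := u)) b = b'"
proof -
  from assms(2) obtain e where e: "e \<in> edges G" "{a', b'} = id(v := u) ` e" "card {a', b'} = 2"
    unfolding contract_def by (auto simp del: fun_upd_apply)
  obtain a b where ab: "e = {a, b}" by (rule simple_edgeE[OF assms(1) e(1)])
  have "{a', b'} = {(id(v := u)) a, (id(v := u)) b}" using e(2) unfolding ab by blast
  then consider "a' = (id(v := u)) a" "b' = (id(v := u)) b" | "a' = (id(v := u)) b" "b' = (id(v := u)) a"
    unfolding doubleton_eq_iff by blast
  then show thesis
    using that[of a b] that[of b a] e(1) unfolding ab by cases (auto simp del: fun_upd_apply simp: insert_commute)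
qed

lemma simple_contract:
  assumes "simple_graph G" "{u, v} \<in> edges G"
  shows "simple_graph (contract u v G)"
proof -
  have "id(v := u) ` e \<subseteq> verts G - {v}" if "e \<in> edges G" for e
    using simple_edgeD[OF assms] that assms(1) unfolding simple_graph_def by auto
  then show ?thesis
    using assms(1) unfolding simple_graph_def contract_def by (auto simp del: fun_upd_apply)
qed

text \<open>\<open>v\<close> joins the branch set of \<open>u\<close>. A cut of the enlarged set
  either separates \<open>u\<close> from \<open>v\<close> and is crossed by \<open>{u, v}\<close>,
  or descends to a cut in the contracted graph. Connectedness is phrased by cuts, not paths, for the
  sake of such arguments.\<close>

lemma clique_labelling_of_contract:
  assumes "simple_graph G" "{u, v} \<in> edges G" "clique_labelling q (contract u v G) f"
  shows "clique_labelling q G (f \<circ> id(v := u))"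
proof -
  define \<phi> where "\<phi> = id(v := u)"
  let ?C = "contract u v G"
  note uv = simple_edgeD[OF assms(1,2)]
  have vC: "verts ?C = verts G - {v}" by (simp add: contract_def)
  have fib: "fibre G (f \<circ> \<phi>) i = {w \<in> verts G. \<phi> w \<in> fibre ?C f i}" for i
    using uv by (auto simp: fibre_def vC \<phi>_def)
  have sub: "fibre ?C f i \<subseteq> fibre G (f \<circ> \<phi>) i" for i
    by (auto simp: fibre_def vC \<phi>_def)
  have pull: "\<exists>a b. {a, b} \<in> edges G \<and> \<phi> a = a' \<and> \<phi> b = b'" if "{a', b'} \<in> edges ?C" for a' b'
    using contract_edgeE[OF assms(1) that] unfolding \<phi>_def by metis
  have conn: "connected_in (edges G) (fibre G (f \<circ> \<phi>) i)" if "i < q" for i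
    unfolding connected_in_def
  proof (intro allI impI, elim conjE)
    fix A assume A: "A \<subset> fibre G (f \<circ> \<phi>) i" "A \<noteq> {}"
    let ?B = "fibre G (f \<circ> \<phi>) i"
    have uvB: "u \<in> ?B \<longleftrightarrow> v \<in> ?B"
      using uv by (auto simp: fibre_def \<phi>_def)
    show "\<exists>a\<in>A. \<exists>b\<in>?B - A. {a, b} \<in> edges G"
    proof (cases "u \<in> A \<longleftrightarrow> v \<in> A")
      case False
      moreover have "{v, u} \<in> edges G" using assms(2) by (simp add: insert_commute)
      ultimately show ?thesis using uvB A(1) assms(2) by blast
    next
      case True
      \<comment> \<open>Membership in \<open>A\<close> can be read off after contraction, so a
        crossing edge pulls back to a crossing edge.\<close>
      have inA: "\<phi> w \<in> A \<longleftrightarrow> w \<in> A" for w using True by (auto simp: \<phi>_def)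
      have img: "\<phi> w \<in> fibre ?C f i" if "w \<in> ?B" for w using that fib by blast
      have ne: "fibre ?C f i \<inter> A \<noteq> {}"
        using A inA img by (metis IntI ex_in_conv psubsetE subsetD)
      obtain w where "w \<in> ?B" "w \<notin> A" using A by blast
      then have ps: "fibre ?C f i \<inter> A \<subset> fibre ?C f i" using inA img by blast
      obtain a' b' where ab': "a' \<in> fibre ?C f i \<inter> A" "b' \<in> fibre ?C f i - A" "{a', b'} \<in> edges ?C"
        using connected_inD[OF clique_labellingD(2)[OF assms(3) \<open>i < q\<close>] ps ne] by blast
      then obtain a b where ab: "{a, b} \<in> edges G" "\<phi> a = a'" "\<phi> b = b'" using pull by blast
      have "a \<in> A" "b \<notin> A" using ab ab' inA by blast+
      moreover have "b \<in> ?B" using ab ab' fib simple_edgeD[OF assms(1) ab(1)] by blast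
      ultimately show ?thesis using ab(1) by blast
    qed
  qed
  have adj: "\<exists>a\<in>fibre G (f \<circ> \<phi>) i. \<exists>b\<in>fibre G (f \<circ> \<phi>) j. {a, b} \<in> edges G"
    if ij: "i < q" "j < q" "i \<noteq> j" for i j
  proof -
    obtain a' b' where ab': "a' \<in> fibre ?C f i" "b' \<in> fibre ?C f j" "{a', b'} \<in> edges ?C"
      using clique_labelling_adjE[OF assms(3) ij] by blast
    then obtain a b where ab: "{a, b} \<in> edges G" "\<phi> a = a'" "\<phi> b = b'" using pull by blast
    then show ?thesis using ab' fib simple_edgeD[OF assms(1) ab(1)] by blast
  qed
  have ne: "fibre G (f \<circ> \<phi>) i \<noteq> {}" if "i < q" for i
    using clique_labellingD(1)[OF assms(3) that] sub[of i] by blast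
  show ?thesis unfolding clique_labelling_def \<phi>_def[symmetric] using conn adj ne by simp
qed

text \<open>Vertices outside \<open>S\<close> get \<open>q\<close>, the least label that means
  deletion.\<close>

lemma clique_labelling_of_subgraph:
  assumes "verts S \<subseteq> verts G" "edges S \<subseteq> edges G" "clique_labelling q S f"
  shows "clique_labelling q G (\<lambda>v. if v \<in> verts S then f v else q)"
  by (rule clique_labelling_transfer[OF assms(3), where \<sigma> = id])
     (use assms(1,2) in \<open>auto simp: fibre_def\<close>)

lemma clique_labelling_of_contractions:
  assumes "edge_contraction\<^sup>*\<^sup>* S M" "simple_graph S" "clique_labelling q M f"
  shows "\<exists>g. clique_labelling q S g"
  using assms
proof (induction rule: converse_rtranclp_induct)
  case base
  then show ?case by blast
next
  case (step y z)
  then obtain u v where uv: "{u, v} \<in> edges y" "z = contract u v y"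
    unfolding edge_contraction_def by blast
  have "simple_graph z" using simple_contract[OF \<open>simple_graph y\<close> uv(1)] uv(2) by simp
  then obtain g where "clique_labelling q z g" using step.IH step.prems by blast
  then show ?case
    using clique_labelling_of_contract[OF \<open>simple_graph y\<close> uv(1)] uv(2) by blast
qed

lemma clique_labelling_of_minor:
  assumes "simple_graph G" "minor (complete_graph q) G"
  shows "\<exists>f. clique_labelling q G f"
proof -
  obtain S M where S: "subgraph S G" and SM: "edge_contraction\<^sup>*\<^sup>* S M" and M: "isomorphic M (complete_graph q)"
    using assms(2) unfolding minor_def by blast
  have simS: "simple_graph S" using S unfolding subgraph_def by blast
  \<comment> \<open>The isomorphism itself labels \<open>M\<close>, with singletons as branch
    sets.\<close>
  obtain f where f: "bij_betw f (verts M) {..<q}"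
    "\<And>u v. u \<in> verts M \<Longrightarrow> v \<in> verts M \<Longrightarrow> {u, v} \<in> edges M \<longleftrightarrow> {f u, f v} \<subseteq> {..<q} \<and> card {f u, f v} = 2"
    using M unfolding isomorphic_def complete_graph_def by auto
  have fibM: "\<exists>a. fibre M f i = {a} \<and> a \<in> verts M \<and> f a = i" if "i < q" for i
  proof -
    obtain a where a: "a \<in> verts M" "f a = i" using f(1) \<open>i < q\<close> unfolding bij_betw_def by (metis imageE lessThan_iff)
    then have "fibre M f i = {a}" using f(1) unfolding bij_betw_def inj_on_def fibre_def by auto
    with a show ?thesis by blast
  qed
  have "connected_in (edges M) {a}" for a unfolding connected_in_def by blast
  moreover have "\<exists>a\<in>fibre M f i. \<exists>b\<in>fibre M f j. {a, b} \<in> edges M" if ij: "i < q" "j < q" "i \<noteq> j" for i j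
    using fibM[OF ij(1)] fibM[OF ij(2)] f(2) ij by auto
  moreover have "fibre M f i \<noteq> {}" if "i < q" for i using fibM[OF that] by auto
  ultimately have "clique_labelling q M f" using fibM unfolding clique_labelling_def
    by metis
  then obtain g where "clique_labelling q S g"
    using clique_labelling_of_contractions[OF SM simS] by blast
  then show ?thesis using clique_labelling_of_subgraph S unfolding subgraph_def by blast
qed

section \<open>From branch sets back to a clique minor\<close>

lemma clique_labelling_contract:
  assumes "simple_graph G" "{u, v} \<in> edges G" "f u = f v" "clique_labelling q G f"
  shows "clique_labelling q (contract u v G) f"
proof -
  define \<phi> where "\<phi> = id(v := u)"
  let ?C = "contract u v G"
  note uv = simple_edgeD[OF assms(1,2)]
  have vC: "verts ?C = verts G - {v}" by (simp add: contract_def)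
  have img: "\<phi> w \<in> fibre ?C f i" if "w \<in> fibre G f i" for w i
    using that uv assms(3) by (auto simp: fibre_def vC \<phi>_def)
  have push: "{\<phi> a, \<phi> b} \<in> edges ?C" if "{a, b} \<in> edges G" "\<phi> a \<noteq> \<phi> b" for a b
    using contract_edgeI that unfolding \<phi>_def by metis
  have conn: "connected_in (edges ?C) (fibre ?C f i)" if "i < q" for i
    unfolding connected_in_def
  proof (intro allI impI, elim conjE)
    fix A assume A: "A \<subset> fibre ?C f i" "A \<noteq> {}"
    \<comment> \<open>With the full preimage of \<open>A\<close>, the ends of an edge leaving
      \<open>A'\<close> have distinct images, so the edge survives contraction.\<close>
    define A' where "A' = {w \<in> fibre G f i. \<phi> w \<in> A}"
    have "\<phi> w = w \<and> w \<in> fibre G f i" if "w \<in> fibre ?C f i" for w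
      using that by (auto simp: fibre_def vC \<phi>_def)
    then have "A \<subseteq> A'" "fibre ?C f i - A \<subseteq> fibre G f i - A'"
      using A by (auto simp: A'_def)
    then have "A' \<noteq> {}" "A' \<subset> fibre G f i" using A by (auto simp: A'_def)
    then obtain a b where ab: "a \<in> A'" "b \<in> fibre G f i - A'" "{a, b} \<in> edges G"
      using connected_inD[OF clique_labellingD(2)[OF assms(4) \<open>i < q\<close>]] by meson
    then have "\<phi> a \<in> A" "\<phi> b \<in> fibre ?C f i - A" using img unfolding A'_def by auto
    then show "\<exists>a\<in>A. \<exists>b\<in>fibre ?C f i - A. {a, b} \<in> edges ?C"
      using push[OF ab(3)] by (metis DiffD2)
  qed
  have adj: "\<exists>a\<in>fibre ?C f i. \<exists>b\<in>fibre ?C f j. {a, b} \<in> edges ?C"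
    if ij: "i < q" "j < q" "i \<noteq> j" for i j
  proof -
    obtain a b where ab: "a \<in> fibre G f i" "b \<in> fibre G f j" "{a, b} \<in> edges G"
      using clique_labelling_adjE[OF assms(4) ij] by blast
    have "\<phi> a \<noteq> \<phi> b" using img[OF ab(1)] img[OF ab(2)] ij(3) by (auto simp: fibre_def)
    then show ?thesis using push[OF ab(3)] img ab by blast
  qed
  have "fibre ?C f i \<noteq> {}" if "i < q" for i
    using img clique_labellingD(1)[OF assms(4) that] by blast
  then show ?thesis using conn adj unfolding clique_labelling_def by simp
qed

text \<open>If a branch set has two vertices, the cut condition at a singleton yields an edge inside
  it to contract, and the vertex count drops. Once \<open>f\<close> is injective, it is the
  isomorphism.\<close>

lemma contraction_to_clique:
  assumes "simple_graph G" "clique_labelling q G f" "\<forall>v\<in>verts G. f v < q"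
  shows "\<exists>M. edge_contraction\<^sup>*\<^sup>* G M \<and> isomorphic M (complete_graph q)"
  using assms
proof (induction "card (verts G)" arbitrary: G rule: less_induct)
  case less
  note simG = \<open>simple_graph G\<close> and lab = \<open>clique_labelling q G f\<close>
  show ?case
  proof (cases "inj_on f (verts G)")
    case True
    have "f ` verts G = {..<q}"
      using lab less.prems(3) unfolding clique_labelling_def fibre_def by force
    then have "bij_betw f (verts G) {..<q}" using True unfolding bij_betw_def by blast
    moreover have "{u, v} \<in> edges G \<longleftrightarrow> {f u, f v} \<subseteq> {..<q} \<and> card {f u, f v} = 2"
      if uv: "u \<in> verts G" "v \<in> verts G" for u v
    proof
      assume "{u, v} \<in> edges G"
      then have "u \<noteq> v" using simple_edgeD[OF simG] by blast
      then have "f u \<noteq> f v" using True uv unfolding inj_on_def by blast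
      then show "{f u, f v} \<subseteq> {..<q} \<and> card {f u, f v} = 2" using less.prems(3) uv by auto
    next
      assume "{f u, f v} \<subseteq> {..<q} \<and> card {f u, f v} = 2"
      then have "f u \<noteq> f v" "f u < q" "f v < q" by auto
      then obtain a b where "a \<in> fibre G f (f u)" "b \<in> fibre G f (f v)" "{a, b} \<in> edges G"
        using clique_labelling_adjE[OF lab] by metis
      moreover from this have "a = u" "b = v" using True uv unfolding fibre_def inj_on_def by auto
      ultimately show "{u, v} \<in> edges G" by blast
    qed
    ultimately have "isomorphic G (complete_graph q)"
      unfolding isomorphic_def complete_graph_def by auto
    then show ?thesis by blast
  next
    case False
    then obtain x y where xy: "x \<in> verts G" "y \<in> verts G" "f x = f y" "x \<noteq> y" unfolding inj_on_def by blast
    let ?B = "fibre G f (f x)"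
    have "{x} \<subset> ?B" using xy unfolding fibre_def by auto
    then obtain b where b: "b \<in> ?B" "{x, b} \<in> edges G"
      using connected_inD[OF clique_labellingD(2)[OF lab], of "f x" "{x}"] less.prems(3) xy(1) by auto
    let ?C = "contract x b G"
    have vC: "verts ?C = verts G - {b}" by (simp add: contract_def)
    have "b \<in> verts G" "f x = f b" using b unfolding fibre_def by auto
    then have "card (verts ?C) < card (verts G)" "clique_labelling q ?C f"
      using simG vC clique_labelling_contract[OF simG b(2) _ lab] card_Diff1_less[of "verts G" b]
      by (auto simp only: simple_graph_def)
    then obtain M where "edge_contraction\<^sup>*\<^sup>* ?C M" "isomorphic M (complete_graph q)"
      using less.hyps[of ?C] simple_contract[OF simG b(2)] less.prems(3) vC by auto
    moreover have "edge_contraction G ?C" using b(2) unfolding edge_contraction_def by blast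
    ultimately show ?thesis by (meson converse_rtranclp_into_rtranclp)
  qed
qed

lemma minor_of_clique_labelling:
  assumes "simple_graph G" "clique_labelling q G f"
  shows "minor (complete_graph q) G"
proof -
  define V where "V = {v \<in> verts G. f v < q}"
  define S where "S = \<lparr>verts = V, edges = {e \<in> edges G. e \<subseteq> V}\<rparr>"
  have sub: "subgraph S G"
    using assms(1) unfolding subgraph_def simple_graph_def S_def V_def by auto
  have "clique_labelling q S f"
    by (rule clique_labelling_transfer[OF assms(2), where \<sigma> = id]) (auto simp: fibre_def S_def V_def)
  moreover have "\<forall>v\<in>verts S. f v < q" by (simp add: S_def V_def)
  ultimately show ?thesis
    using contraction_to_clique[of S q f] sub unfolding minor_def subgraph_def by blast
qed

section \<open>Relabelling, disjoint unions and cones\<close>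

text \<open>Serves to move graphs to \<open>nat\<close>, the vertex type of the density hypothesis,
  and to make summands disjoint.\<close>

definition relabel :: "('a \<Rightarrow> 'b) \<Rightarrow> 'a ugraph \<Rightarrow> 'b ugraph" where
  "relabel g G = \<lparr>verts = g ` verts G, edges = (\<lambda>e. g ` e) ` edges G\<rparr>"

lemma relabel_card:
  assumes "simple_graph G" "inj_on g (verts G)"
  shows "card (verts (relabel g G)) = card (verts G)" "card (edges (relabel g G)) = card (edges G)"
proof -
  have "inj_on ((`) g) (edges G)"
    by (rule inj_on_subset[OF inj_on_image_Pow[OF assms(2)]]) (use assms(1) in \<open>auto simp: simple_graph_def\<close>)
  then show "card (verts (relabel g G)) = card (verts G)" "card (edges (relabel g G)) = card (edges G)"
    using assms(2) by (auto simp: relabel_def card_image)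
qed

lemma simple_relabel:
  assumes "simple_graph G" "inj_on g (verts G)"
  shows "simple_graph (relabel g G)"
proof -
  have "card (g ` e) = 2" if "e \<in> edges G" for e
    using assms that card_image[OF inj_on_subset[OF assms(2)], of e] by (auto simp: simple_graph_def)
  then show ?thesis using assms by (auto simp: simple_graph_def relabel_def)
qed

lemma colorable_of_relabel:
  assumes "colorable c (relabel g G)"
  shows "colorable c G"
proof -
  obtain f :: "_ \<Rightarrow> nat" where f: "\<forall>v\<in>verts (relabel g G). f v < c"
    "\<And>u v. {u, v} \<in> edges (relabel g G) \<Longrightarrow> f u \<noteq> f v"
    using assms unfolding colorable_def by blast
  have "f (g u) \<noteq> f (g v)" if "{u, v} \<in> edges G" for u v
  proof -
    have "g ` {u, v} \<in> edges (relabel g G)" using that unfolding relabel_def by (simp only: ugraph.simps) blast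
    then show ?thesis using f(2)[of "g u" "g v"] by simp
  qed
  moreover have "\<forall>v\<in>verts G. f (g v) < c" using f(1) by (simp add: relabel_def)
  ultimately show ?thesis unfolding colorable_def by (intro exI[of _ "f \<circ> g"]) simp
qed

lemma clique_labelling_of_relabel:
  assumes "simple_graph G" "inj_on g (verts G)" "clique_labelling q (relabel g G) f"
  shows "clique_labelling q G (f \<circ> g)"
proof -
  let ?R = "relabel g G"
  have fib: "fibre ?R f i = g ` fibre G (f \<circ> g) i" for i
    by (auto simp: fibre_def relabel_def)
  have sub: "fibre G (f \<circ> g) i \<subseteq> verts G" for i by (auto simp: fibre_def)
  have edge: "{a, b} \<in> edges G" if abR: "a \<in> verts G" "b \<in> verts G" "{g a, g b} \<in> edges ?R" for a b
  proof -
    obtain e where e: "e \<in> edges G" "g ` {a, b} = g ` e" using abR(3) by (auto simp: relabel_def)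
    moreover have "e \<subseteq> verts G" using e(1) assms(1) by (auto simp: simple_graph_def)
    ultimately have "{a, b} = e"
      using abR inj_on_image_eq_iff[OF assms(2), of "{a, b}" e] by simp
    then show ?thesis using e(1) by simp
  qed
  have "connected_in (edges G) (fibre G (f \<circ> g) i)" if iq: "i < q" for i
    unfolding connected_in_def
  proof (intro allI impI, elim conjE)
    let ?B = "fibre G (f \<circ> g) i"
    fix A assume A: "A \<subset> ?B" "A \<noteq> {}"
    then obtain x where x: "x \<in> ?B" "x \<notin> A" by blast
    have AV: "A \<subseteq> verts G" using A sub by blast
    have "g x \<notin> g ` A" using x sub AV assms(2) by (meson inj_on_image_mem_iff subsetD)
    then have "g ` A \<subset> fibre ?R f i" using A x unfolding fib by blast
    then obtain a' b' where ab: "a' \<in> g ` A" "b' \<in> fibre ?R f i - g ` A" "{a', b'} \<in> edges ?R"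
      using connected_inD[OF clique_labellingD(2)[OF assms(3) iq], of "g ` A"] A by auto
    then obtain a b where "a \<in> A" "a' = g a" "b \<in> ?B" "b' = g b" unfolding fib by blast
    then show "\<exists>a\<in>A. \<exists>b\<in>?B - A. {a, b} \<in> edges G"
      using edge[of a b] ab AV sub by blast
  qed
  moreover have "\<exists>a\<in>fibre G (f \<circ> g) i. \<exists>b\<in>fibre G (f \<circ> g) j. {a, b} \<in> edges G"
    if ij: "i < q" "j < q" "i \<noteq> j" for i j
  proof -
    obtain a' b' where "a' \<in> fibre ?R f i" "b' \<in> fibre ?R f j" "{a', b'} \<in> edges ?R"
      using clique_labelling_adjE[OF assms(3) ij] by blast
    then obtain a b where "a \<in> fibre G (f \<circ> g) i" "b \<in> fibre G (f \<circ> g) j" "{g a, g b} \<in> edges ?R"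
      unfolding fib by blast
    then show ?thesis using edge[of a b] sub by blast
  qed
  moreover have "fibre G (f \<circ> g) i \<noteq> {}" if "i < q" for i
    using clique_labellingD(1)[OF assms(3) that] unfolding fib by blast
  ultimately show ?thesis unfolding clique_labelling_def by simp
qed

section \<open>Disjoint unions\<close>

definition disjoint_union :: "'a ugraph \<Rightarrow> 'a ugraph \<Rightarrow> 'a ugraph" where
  "disjoint_union G H = \<lparr>verts = verts G \<union> verts H, edges = edges G \<union> edges H\<rparr>"

lemma disjoint_union_commute: "disjoint_union G H = disjoint_union H G"
  by (auto simp: disjoint_union_def)

lemma disjoint_union_fibre_side:
  assumes sim: "simple_graph G" "simple_graph H" and dis: "verts G \<inter> verts H = {}"
    and B: "connected_in (edges (disjoint_union G H)) B" "B \<subseteq> verts G \<union> verts H"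
  shows "B \<subseteq> verts G \<or> B \<subseteq> verts H"
proof (rule ccontr)
  assume "\<not> ?thesis"
  then have "B \<inter> verts G \<noteq> {}" "B \<inter> verts G \<subset> B" using B(2) by blast+
  then obtain a b where ab: "a \<in> verts G" "b \<in> B" "b \<notin> verts G" "{a, b} \<in> edges G \<union> edges H"
    using connected_inD[OF B(1), of "B \<inter> verts G"] by (auto simp: disjoint_union_def)
  then show False
    using simple_edgeD[OF sim(1), of a b] simple_edgeD[OF sim(2), of a b] dis by blast
qed

lemma disjoint_union_edge:
  assumes "simple_graph H" "verts G \<inter> verts H = {}" "{a, b} \<in> edges (disjoint_union G H)" "a \<in> verts G"
  shows "{a, b} \<in> edges G"
  using assms simple_edgeD(1)[OF assms(1), of a b] by (auto simp: disjoint_union_def)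

text \<open>Branch set 0 is an anchor: every other one is adjacent to it, hence meets
  \<open>G\<close>, and by connectedness stays there.\<close>

lemma clique_labelling_disjoint_union_left:
  assumes sim: "simple_graph G" "simple_graph H" and dis: "verts G \<inter> verts H = {}"
    and lab: "clique_labelling q (disjoint_union G H) f"
    and G0: "fibre (disjoint_union G H) f 0 \<subseteq> verts G" and "0 < q"
  shows "clique_labelling q G f"
proof -
  let ?U = "disjoint_union G H"
  have side: "fibre ?U f i \<subseteq> verts G" if iq: "i < q" for i
  proof (cases "i = 0")
    case False
    obtain a b where ab: "a \<in> fibre ?U f 0" "b \<in> fibre ?U f i" "{a, b} \<in> edges ?U"
      using clique_labelling_adjE[OF lab \<open>0 < q\<close> iq] False by metis
    then have "b \<in> verts G"
      using disjoint_union_edge[OF sim(2) dis ab(3)] G0 simple_edgeD(2)[OF sim(1), of a b] by blast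
    moreover have "fibre ?U f i \<subseteq> verts G \<or> fibre ?U f i \<subseteq> verts H"
      by (rule disjoint_union_fibre_side[OF sim dis clique_labellingD(2)[OF lab iq]])
         (auto simp: fibre_def disjoint_union_def)
    ultimately show ?thesis using ab(2) dis by blast
  qed (use G0 in simp)
  have fib: "fibre G f i = fibre ?U f (id i)" if "i < q" for i
    using side[OF that] by (auto simp: fibre_def disjoint_union_def)
  show ?thesis
    by (rule clique_labelling_transfer[OF lab _ _ fib])
       (use disjoint_union_edge[OF sim(2) dis] in \<open>auto simp: fibre_def\<close>)
qed

lemma clique_labelling_disjoint_union:
  assumes sim: "simple_graph G" "simple_graph H" and dis: "verts G \<inter> verts H = {}"
    and lab: "clique_labelling q (disjoint_union G H) f" and "0 < q"
  shows "clique_labelling q G f \<or> clique_labelling q H f"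
proof -
  have "fibre (disjoint_union G H) f 0 \<subseteq> verts G \<or> fibre (disjoint_union G H) f 0 \<subseteq> verts H"
    by (rule disjoint_union_fibre_side[OF sim dis clique_labellingD(2)[OF lab \<open>0 < q\<close>]])
       (auto simp: fibre_def disjoint_union_def)
  then show ?thesis
    using clique_labelling_disjoint_union_left[of G H q f] clique_labelling_disjoint_union_left[of H G q f]
      assms disjoint_union_commute[of G H] by (metis Int_commute)
qed

text \<open>Colourability is tracked for \<open>G\<close> alone, the summand that will carry the
  chromatic obstruction.\<close>

lemma exists_disjoint_union:
  fixes G :: "'a ugraph" and H :: "'b ugraph"
  assumes sim: "simple_graph G" "simple_graph H" and "0 < q"
    and no: "\<nexists>f. clique_labelling q G f" "\<nexists>f. clique_labelling q H f"
  shows "\<exists>U :: nat ugraph. simple_graph U \<and> (\<nexists>f. clique_labelling q U f) \<and>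
    card (verts U) = card (verts G) + card (verts H) \<and>
    card (edges U) = card (edges G) + card (edges H) \<and>
    (\<forall>c. colorable c U \<longrightarrow> colorable c G)"
proof -
  have fin: "finite (verts G)" "finite (verts H)" using sim by (auto simp: simple_graph_def)
  obtain g :: "'a \<Rightarrow> nat" where g: "inj_on g (verts G)"
    using finite_imp_inj_to_nat_seg[OF fin(1)] by auto
  obtain h :: "'b \<Rightarrow> nat" where h: "inj_on h (verts H)"
    using finite_imp_inj_to_nat_seg[OF fin(2)] by auto
  \<comment> \<open>Even and odd codes keep the summands apart.\<close>
  define G' where "G' = relabel (\<lambda>x. 2 * g x) G"
  define H' where "H' = relabel (\<lambda>x. 2 * h x + 1) H"
  have g': "inj_on (\<lambda>x. 2 * g x) (verts G)" and h': "inj_on (\<lambda>x. 2 * h x + 1) (verts H)"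
    using g h by (auto simp: inj_on_def)
  have sim': "simple_graph G'" "simple_graph H'"
    using simple_relabel[OF sim(1) g'] simple_relabel[OF sim(2) h'] unfolding G'_def H'_def .
  have dis: "verts G' \<inter> verts H' = {}"
    by (auto simp: G'_def H'_def relabel_def) presburger
  have "e \<notin> edges H'" if eG: "e \<in> edges G'" for e
  proof -
    obtain a b where "e = {a, b}" "a \<in> verts G'" using simple_edgeE[OF sim'(1) eG] by metis
    then show ?thesis using simple_edgeD(1)[OF sim'(2), of a b] dis by blast
  qed
  then have disE: "edges G' \<inter> edges H' = {}" by blast
  let ?U = "disjoint_union G' H'"
  have "simple_graph ?U" using sim' by (auto simp: simple_graph_def disjoint_union_def)
  moreover have "\<nexists>f. clique_labelling q ?U f"
    using clique_labelling_disjoint_union[OF sim' dis _ \<open>0 < q\<close>] no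
      clique_labelling_of_relabel[OF sim(1) g'] clique_labelling_of_relabel[OF sim(2) h']
    unfolding G'_def H'_def by blast
  moreover have "card (verts ?U) = card (verts G) + card (verts H)"
    using card_Un_disjoint[OF _ _ dis] sim' relabel_card(1)[OF sim(1) g'] relabel_card(1)[OF sim(2) h']
    by (auto simp: disjoint_union_def simple_graph_def G'_def H'_def)
  moreover have "card (edges ?U) = card (edges G) + card (edges H)"
    using card_Un_disjoint[OF finite_edges[OF sim'(1)] finite_edges[OF sim'(2)] disE]
      relabel_card(2)[OF sim(1) g'] relabel_card(2)[OF sim(2) h']
    by (auto simp: disjoint_union_def G'_def H'_def)
  moreover have "colorable c G" if "colorable c ?U" for c
  proof -
    have "colorable c G'" using that unfolding colorable_def disjoint_union_def by auto
    then show ?thesis unfolding G'_def by (rule colorable_of_relabel)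
  qed
  ultimately show ?thesis by blast
qed

lemma exists_copies:
  fixes F :: "nat ugraph"
  assumes "simple_graph F" "0 < q" "\<nexists>f. clique_labelling q F f"
  shows "\<exists>U :: nat ugraph. simple_graph U \<and> (\<nexists>f. clique_labelling q U f) \<and>
    card (verts U) = t * card (verts F) \<and> card (edges U) = t * card (edges F)"
proof (induction t)
  case 0
  have "\<not> clique_labelling q \<lparr>verts = {}, edges = {}\<rparr> f" for f :: "nat \<Rightarrow> nat"
    using clique_labellingD(1)[OF _ assms(2)] by (force simp: fibre_def)
  then show ?case by (intro exI[of _ "\<lparr>verts = {}, edges = {}\<rparr>"]) (auto simp: simple_graph_def)
next
  case (Suc t)
  then obtain U :: "nat ugraph" where U: "simple_graph U" "\<nexists>f. clique_labelling q U f"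
    "card (verts U) = t * card (verts F)" "card (edges U) = t * card (edges F)" by blast
  show ?case using exists_disjoint_union[OF assms(1) U(1) assms(2,3) U(2)] U(3,4) by auto
qed

text \<open>The join with a clique on \<open>m\<close> vertices is obtained as \<open>m\<close>
  successive cones.\<close>

definition cone :: "'a \<Rightarrow> 'a ugraph \<Rightarrow> 'a ugraph" where
  "cone w G = \<lparr>verts = insert w (verts G), edges = edges G \<union> (\<lambda>v. {w, v}) ` verts G\<rparr>"

lemma simple_cone:
  assumes "simple_graph G" "w \<notin> verts G"
  shows "simple_graph (cone w G)"
  using assms by (auto simp: simple_graph_def cone_def card_2_iff)

lemma card_edges_cone:
  assumes "simple_graph G" "w \<notin> verts G"
  shows "card (edges (cone w G)) = card (edges G) + card (verts G)"
proof -
  have "edges G \<inter> (\<lambda>v. {w, v}) ` verts G = {}" using assms by (auto simp: simple_graph_def)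
  moreover have "inj_on (\<lambda>v. {w, v}) (verts G)" by (auto simp: inj_on_def doubleton_eq_iff)
  ultimately show ?thesis
    using assms finite_edges[OF assms(1)] by (auto simp: cone_def simple_graph_def card_Un_disjoint card_image)
qed

lemma clique_labelling_of_cone:
  assumes "w \<notin> verts G" "clique_labelling (Suc q) (cone w G) f"
  shows "\<exists>g. clique_labelling q G g"
proof -
  \<comment> \<open>The branch set to give up: the one containing \<open>w\<close>, or the last one
    if \<open>w\<close> is deleted. Swapping its index with \<open>q\<close> leaves the labels below
    \<open>q\<close> to the others.\<close>
  define i0 where "i0 = min (f w) q"
  define \<sigma> where "\<sigma> i = (if i = i0 then q else i)" for i
  define g where "g v = (if f v = i0 then q else if f v = q then i0 else f v)" for v
  have "clique_labelling q G g"
  proof (rule clique_labelling_transfer[OF assms(2), where \<sigma> = \<sigma>])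
    show "inj_on \<sigma> {..<q}" by (auto simp: inj_on_def \<sigma>_def)
    show "fibre G g i = fibre (cone w G) f (\<sigma> i)" if "i < q" for i
      using that assms(1) by (auto simp: fibre_def cone_def g_def \<sigma>_def i0_def min_def split: if_splits)
    fix i j a b
    assume "a \<in> fibre G g i" "b \<in> fibre G g j" "{a, b} \<in> edges (cone w G)"
    then show "{a, b} \<in> edges G" using assms(1) by (auto simp: fibre_def cone_def doubleton_eq_iff)
  qed (auto simp: \<sigma>_def)
  then show ?thesis by blast
qed

lemma colorable_of_cone:
  assumes "simple_graph G" "w \<notin> verts G" "colorable (Suc c) (cone w G)"
  shows "colorable c G"
proof -
  obtain f :: "_ \<Rightarrow> nat" where f: "\<forall>v\<in>verts (cone w G). f v < Suc c"
    "\<And>u v. {u, v} \<in> edges (cone w G) \<Longrightarrow> f u \<noteq> f v"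
    using assms(3) unfolding colorable_def by blast
  have fw: "f v \<noteq> f w" if "v \<in> verts G" for v
    using f(2)[of w v] that by (auto simp: cone_def)
  \<comment> \<open>No vertex of \<open>G\<close> has the colour of \<open>w\<close>, so that colour
    can replace \<open>c\<close>.\<close>
  define g where "g v = (if f v = c then f w else f v)" for v
  have "g v < c" if "v \<in> verts G" for v
    using f(1) fw[OF that] that by (auto simp: g_def cone_def less_Suc_eq)
  moreover have "g u \<noteq> g v" if uv: "{u, v} \<in> edges G" for u v
    using f(2)[of u v] fw[of u] fw[of v] simple_edgeD[OF assms(1) uv] uv by (auto simp: g_def cone_def)
  ultimately show ?thesis unfolding colorable_def by blast
qed

text \<open>Edges among the new vertices are left out of the count, hence an inequality. The case
  \<open>m = 0\<close> already carries \<open>G\<close> over to \<open>nat\<close>.\<close>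

lemma exists_cones:
  fixes G :: "'a ugraph"
  assumes "simple_graph G" "\<nexists>f. clique_labelling q G f"
  shows "\<exists>U :: nat ugraph. simple_graph U \<and> (\<nexists>f. clique_labelling (q + m) U f) \<and>
    card (verts U) = card (verts G) + m \<and>
    card (edges G) + m * card (verts G) \<le> card (edges U) \<and>
    (\<forall>c. colorable (c + m) U \<longrightarrow> colorable c G)"
proof (induction m)
  case 0
  obtain g :: "'a \<Rightarrow> nat" where g: "inj_on g (verts G)"
    using assms(1) finite_imp_inj_to_nat_seg[of "verts G"] unfolding simple_graph_def by blast
  show ?case
    using simple_relabel[OF assms(1) g] relabel_card[OF assms(1) g]
      clique_labelling_of_relabel[OF assms(1) g] assms(2) colorable_of_relabel[of _ g G]
    by (intro exI[of _ "relabel g G"]) auto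
next
  case (Suc m)
  then obtain U :: "nat ugraph" where U: "simple_graph U" "\<nexists>f. clique_labelling (q + m) U f"
    "card (verts U) = card (verts G) + m" "card (edges G) + m * card (verts G) \<le> card (edges U)"
    "\<And>c. colorable (c + m) U \<Longrightarrow> colorable c G" by blast
  obtain w where w: "w \<notin> verts U" using U(1) ex_new_if_finite[OF infinite_UNIV_nat, of "verts U"] unfolding simple_graph_def by blast
  have "\<nexists>f. clique_labelling (q + Suc m) (cone w U) f"
    using clique_labelling_of_cone[OF w] U(2) by (metis add_Suc_right)
  moreover have "card (verts (cone w U)) = card (verts G) + Suc m"
    using w U(1,3) by (simp add: cone_def simple_graph_def)
  moreover have "card (edges G) + Suc m * card (verts G) \<le> card (edges (cone w U))"
    using card_edges_cone[OF U(1) w] U(3,4) by simp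
  moreover have "\<forall>c. colorable (c + Suc m) (cone w U) \<longrightarrow> colorable c G"
    using colorable_of_cone[OF U(1) w] U(5) by (metis add_Suc_right)
  ultimately show ?case using simple_cone[OF U(1) w] by blast
qed

section \<open>A dense graph without a large clique minor\<close>

text \<open>For a uniformly random \<open>E\<close>, the events of hitting the disjoint blocks
  \<open>X j\<close> are independent, each of probability at most \<open>1 - 2^(-c)\<close>; the
  statement is the product bound cleared of denominators.\<close>

lemma card_hitting:
  fixes X :: "'j \<Rightarrow> 'e set"
  assumes "finite J" "finite P" "\<And>j. j \<in> J \<Longrightarrow> X j \<subseteq> P" "\<And>j. j \<in> J \<Longrightarrow> card (X j) \<le> c"
    "\<And>i j. i \<in> J \<Longrightarrow> j \<in> J \<Longrightarrow> i \<noteq> j \<Longrightarrow> X i \<inter> X j = {}"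
  shows "card {E. E \<subseteq> P \<and> (\<forall>j\<in>J. E \<inter> X j \<noteq> {})} * (2 ^ c) ^ card J \<le> 2 ^ card P * (2 ^ c - 1) ^ card J"
  using assms
proof (induction J arbitrary: P rule: finite_induct)
  case empty
  have "{E. E \<subseteq> P} = Pow P" by blast
  then show ?case using empty(1) by (simp add: card_Pow)
next
  case (insert j J)
  define Y where "Y = X j"
  define x where "x = card Y"
  let ?T = "{E. E \<subseteq> P \<and> (\<forall>i\<in>insert j J. E \<inter> X i \<noteq> {})}"
  let ?S = "{E. E \<subseteq> P - Y \<and> (\<forall>i\<in>J. E \<inter> X i \<noteq> {})}"
  have Y: "Y \<subseteq> P" "finite Y" "x \<le> c"
    using insert.prems finite_subset[of "X j" P] unfolding Y_def x_def by auto
  have dis: "Y \<inter> X i = {}" if "i \<in> J" for i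
    using insert.prems(4)[of j i] insert.hyps(2) that unfolding Y_def by auto
  \<comment> \<open>Split \<open>E\<close> into its nonempty trace on \<open>Y\<close> and the rest,
    which still hits the other blocks because they avoid \<open>Y\<close>.\<close>
  have "card ?T \<le> card ((Pow Y - {{}}) \<times> ?S)"
  proof (rule card_inj_on_le[where f = "\<lambda>E. (E \<inter> Y, E - Y)"])
    show "inj_on (\<lambda>E. (E \<inter> Y, E - Y)) ?T" by (auto simp: inj_on_def)
    show "(\<lambda>E. (E \<inter> Y, E - Y)) ` ?T \<subseteq> (Pow Y - {{}}) \<times> ?S"
    proof (rule image_subsetI)
      fix E assume E: "E \<in> ?T"
      have "(E - Y) \<inter> X i \<noteq> {}" if "i \<in> J" for i using E dis[OF that] that by blast
      moreover have "E \<inter> Y \<noteq> {}" using E unfolding Y_def by blast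
      ultimately show "(E \<inter> Y, E - Y) \<in> (Pow Y - {{}}) \<times> ?S" using E by blast
    qed
    show "finite ((Pow Y - {{}}) \<times> ?S)"
      using Y(2) insert.prems(1) by (intro finite_cartesian_product finite_Diff finite_Pow_iff[THEN iffD2]
        finite_subset[of ?S "Pow P"]) auto
  qed
  also have "\<dots> = (2 ^ x - 1) * card ?S"
    using Y(2) by (simp add: card_cartesian_product card_Diff_singleton card_Pow x_def)
  finally have T: "card ?T \<le> (2 ^ x - 1) * card ?S" .
  have IH: "card ?S * (2 ^ c) ^ card J \<le> 2 ^ card (P - Y) * (2 ^ c - 1) ^ card J"
  proof (rule insert.IH)
    show "X i \<subseteq> P - Y" if "i \<in> J" for i using insert.prems(2)[of i] dis[OF that] that by blast
  qed (use insert.prems in auto)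
  have P: "(2::nat) ^ card P = 2 ^ x * 2 ^ card (P - Y)"
    using card_Diff_subset[OF Y(2,1)] card_mono[OF insert.prems(1) Y(1)]
    by (simp add: power_add[symmetric] x_def)
  \<comment> \<open>That is, \<open>1 - 2^(-x) \<le> 1 - 2^(-c)\<close> for
    \<open>x \<le> c\<close>.\<close>
  have xc: "(2 ^ x - 1) * 2 ^ c \<le> 2 ^ x * (2 ^ c - 1 :: nat)"
    using power_increasing[OF Y(3), of "2::nat"] by (simp add: algebra_simps diff_le_mono2)
  have "card ?T * (2 ^ c) ^ card (insert j J) \<le> (2 ^ x - 1) * card ?S * (2 ^ c * (2 ^ c) ^ card J)"
    using T insert.hyps by simp
  also have "\<dots> = ((2 ^ x - 1) * 2 ^ c) * (card ?S * (2 ^ c) ^ card J)" by (simp only: ac_simps)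
  also have "\<dots> \<le> (2 ^ x * (2 ^ c - 1)) * (2 ^ card (P - Y) * (2 ^ c - 1) ^ card J)"
    by (rule mult_le_mono[OF xc IH])
  also have "\<dots> = 2 ^ card P * (2 ^ c - 1) ^ card (insert j J)"
    unfolding P card_insert_disjoint[OF insert.hyps] by (simp only: power_Suc ac_simps)
  finally show ?case .
qed

text \<open>Complementation injects the sparse sets into the sets with more than half of the
  elements, a disjoint family.\<close>

lemma card_sparse_subsets:
  assumes "finite P"
  shows "2 * card {E. E \<subseteq> P \<and> 2 * card E < card P} \<le> 2 ^ card P"
proof -
  let ?S = "{E. E \<subseteq> P \<and> 2 * card E < card P}" and ?D = "{E. E \<subseteq> P \<and> card P < 2 * card E}"
  have fin: "finite ?S" "finite ?D" using assms by (auto intro: finite_subset[of _ "Pow P"])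
  have "card ?S \<le> card ?D"
  proof (rule card_inj_on_le[OF _ _ fin(2)])
    show "inj_on (\<lambda>E. P - E) ?S" by (auto simp: inj_on_def)
    show "(\<lambda>E. P - E) ` ?S \<subseteq> ?D"
    proof (rule image_subsetI)
      fix E assume E: "E \<in> ?S"
      then have "card (P - E) = card P - card E"
        using card_Diff_subset finite_subset[OF _ assms] by blast
      then show "P - E \<in> ?D" using E by auto
    qed
  qed
  moreover have "card ?S + card ?D = card (?S \<union> ?D)"
    by (rule card_Un_disjoint[OF fin, symmetric]) auto
  moreover have "card (?S \<union> ?D) \<le> card (Pow P)"
    using assms by (intro card_mono) auto
  ultimately show ?thesis using assms by (simp add: card_Pow)
qed

text \<open>This is \<open>(1 - 1/x)^x \<le> 1/2\<close> raised to the power \<open>m\<close>; the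
  remaining factors are at most 1.\<close>

lemma power_ratio_half:
  fixes x m C :: nat
  assumes "0 < x" "x * m \<le> C"
  shows "(x - 1) ^ C * 2 ^ m \<le> x ^ C"
proof (cases "x - 1")
  case 0
  then show ?thesis using assms by (cases "C = 0") (auto simp: power_0_left)
next
  case (Suc y')
  define y where "y = Suc y'"
  have x: "x = Suc y" using Suc unfolding y_def by simp
  \<comment> \<open>Bernoulli's inequality \<open>(1 + 1/y)^n \<ge> 1 + n/y\<close>; at
    \<open>n = x\<close> the right side exceeds 2.\<close>
  have bern: "y ^ n * (y + n) \<le> (y + 1) ^ n * y" for n
  proof (induction n)
    case (Suc n)
    have "y ^ Suc n * (y + Suc n) \<le> (y + 1) * (y ^ n * (y + n))" by (simp add: algebra_simps)
    also have "\<dots> \<le> (y + 1) * ((y + 1) ^ n * y)" using Suc.IH by (rule mult_le_mono2)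
    finally show ?case by (simp add: algebra_simps)
  qed simp
  have "(y ^ x * 2) * y \<le> y ^ x * (y + x)" by (simp add: x algebra_simps)
  also have "\<dots> \<le> x ^ x * y" using bern[of x] by (simp add: x)
  finally have "y ^ x * 2 \<le> x ^ x" by (rule mult_right_le_imp_le) (simp add: y_def)
  then have "(y ^ x * 2) ^ m \<le> (x ^ x) ^ m" by (rule power_mono) simp
  then have "y ^ (x * m) * 2 ^ m \<le> x ^ (x * m)" by (simp add: power_mult_distrib power_mult)
  moreover have "y ^ (C - x * m) \<le> x ^ (C - x * m)" by (rule power_mono) (simp_all add: x)
  ultimately have "(y ^ (x * m) * 2 ^ m) * y ^ (C - x * m) \<le> x ^ (x * m) * x ^ (C - x * m)"
    by (rule mult_le_mono)
  then have "y ^ (x * m + (C - x * m)) * 2 ^ m \<le> x ^ (x * m + (C - x * m))"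
    by (simp only: power_add ac_simps)
  then show ?thesis using assms by (simp add: x)
qed

text \<open>Each large fibre uses at least nine of the \<open>8r\<close> vertices, so at most
  \<open>r\<close> of the \<open>2r\<close> labels have one.\<close>

lemma many_small_fibres:
  fixes f :: "'a \<Rightarrow> nat"
  assumes "finite V" "card V = 8 * r"
  shows "\<exists>I. I \<subseteq> {..<2 * r} \<and> card I = r \<and> (\<forall>i\<in>I. card {v \<in> V. f v = i} \<le> 8)"
proof -
  let ?F = "\<lambda>i. {v \<in> V. f v = i}"
  define L where "L = {i \<in> {..<2 * r}. 8 < card (?F i)}"
  define S where "S = {i \<in> {..<2 * r}. card (?F i) \<le> 8}"
  have "9 * card L \<le> (\<Sum>i\<in>L. card (?F i))"
    using sum_bounded_below[of L 9 "\<lambda>i. card (?F i)"] by (auto simp: L_def)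
  also have "\<dots> = card (\<Union>i\<in>L. ?F i)"
    by (rule card_UN_disjoint[symmetric]) (use assms in \<open>auto simp: L_def\<close>)
  also have "\<dots> \<le> card V" by (rule card_mono) (use assms in auto)
  finally have "card L \<le> r" using assms(2) by simp
  moreover have "card L + card S = card (L \<union> S)"
    by (rule card_Un_disjoint[symmetric]) (auto simp: L_def S_def)
  moreover have "L \<union> S = {..<2 * r}" by (auto simp: L_def S_def)
  ultimately have "r \<le> card S" by simp
  then obtain I where "I \<subseteq> S" "card I = r" by (metis obtain_subset_with_card_n)
  then show ?thesis unfolding S_def by blast
qed

section \<open>Random graphs on \<open>8r\<close> vertices\<close>

abbreviation pairs :: "nat \<Rightarrow> nat set set" where
  "pairs n \<equiv> {e. e \<subseteq> {..<n} \<and> card e = 2}"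

text \<open>Such an edge has one end in each of two fibres, giving at most \<open>8 * 8\<close>
  choices.\<close>

lemma card_pairs_over:
  fixes f :: "nat \<Rightarrow> nat"
  assumes "card T = 2" "\<forall>i\<in>T. card {v \<in> {..<n}. f v = i} \<le> 8"
  shows "card {e \<in> pairs n. f ` e = T} \<le> 64"
proof -
  obtain i j where T: "T = {i, j}" "i \<noteq> j" using assms(1) by (auto simp: card_2_iff)
  let ?F = "\<lambda>i. {v \<in> {..<n}. f v = i}"
  have "{e \<in> pairs n. f ` e = T} \<subseteq> (\<lambda>(a, b). {a, b}) ` (?F i \<times> ?F j)"
  proof
    fix e assume e: "e \<in> {e \<in> pairs n. f ` e = T}"
    then obtain a b where ab: "e = {a, b}" by (auto simp: card_2_iff)
    then consider "f a = i" "f b = j" | "f a = j" "f b = i"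
      using e T by (auto simp: doubleton_eq_iff)
    then show "e \<in> (\<lambda>(a, b). {a, b}) ` (?F i \<times> ?F j)"
    proof cases
      case 1
      then show ?thesis using e ab by (intro image_eqI[of _ _ "(a, b)"]) auto
    next
      case 2
      then show ?thesis using e ab by (intro image_eqI[of _ _ "(b, a)"]) auto
    qed
  qed
  then have "card {e \<in> pairs n. f ` e = T} \<le> card ((\<lambda>(a, b). {a, b}) ` (?F i \<times> ?F j))"
    by (intro card_mono) auto
  also have "\<dots> \<le> card (?F i) * card (?F j)"
    using card_image_le[of "?F i \<times> ?F j" "\<lambda>(a, b). {a, b}"] by (simp add: card_cartesian_product)
  also have "\<dots> \<le> 8 * 8" by (rule mult_le_mono) (use assms(2) T in auto)
  finally show ?thesis by simp
qed

text \<open>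
  A union bound over all labellings of \<open>8r\<close> vertices by \<open>2r\<close> labels and one label for deletion: at least \<open>r\<close>
  fibres have at most 8 elements, so that any two of them are joined by an edge in at most a fraction
  \<open>1 - 2\<^sup>-\<^sup>6\<^sup>4\<close> of all graphs, independently for distinct pairs. Connectedness of the branch sets is ignored.
\<close>

lemma card_clique_labelled_graphs:
  fixes r :: nat
  defines "n \<equiv> 8 * r" and "C \<equiv> r choose 2"
  shows "card {E. E \<subseteq> pairs n \<and> (\<exists>f. clique_labelling (2 * r) \<lparr>verts = {..<n}, edges = E\<rparr> f)} * (2 ^ 64) ^ C
    \<le> (2 * r + 1) ^ n * (2 ^ card (pairs n) * (2 ^ 64 - 1) ^ C)"
proof -
  let ?V = "{..<n}"
  define I where "I f = (SOME I. I \<subseteq> {..<2 * r} \<and> card I = r \<and> (\<forall>i\<in>I. card {v \<in> ?V. f v = i} \<le> 8))"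
    for f :: "nat \<Rightarrow> nat"
  have "I f \<subseteq> {..<2 * r} \<and> card (I f) = r \<and> (\<forall>i\<in>I f. card {v \<in> ?V. f v = i} \<le> 8)" for f
    unfolding I_def by (rule someI_ex, rule many_small_fibres) (auto simp: n_def)
  then have I: "\<And>f. I f \<subseteq> {..<2 * r}" "\<And>f. card (I f) = r"
    "\<And>f i. i \<in> I f \<Longrightarrow> card {v \<in> ?V. f v = i} \<le> 8"
    by simp_all
  define J where "J f = {T. T \<subseteq> I f \<and> card T = 2}" for f
  \<comment> \<open>The possible edges between the two fibres named by \<open>T\<close>. An edge
    determines its image, so distinct \<open>T\<close> give the disjoint blocks that
    \<open>card_hitting\<close> asks for.\<close>
  define X where "X f T = {e \<in> pairs n. f ` e = T}" for f :: "nat \<Rightarrow> nat" and T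
  define Hit where "Hit f = {E. E \<subseteq> pairs n \<and> (\<forall>T\<in>J f. E \<inter> X f T \<noteq> {})}" for f
  let ?Bad = "{E. E \<subseteq> pairs n \<and> (\<exists>f. clique_labelling (2 * r) \<lparr>verts = ?V, edges = E\<rparr> f)}"
  let ?Fs = "?V \<rightarrow>\<^sub>E {..2 * r}"
  have finP: "finite (pairs n)" by (rule finite_subset[of _ "Pow ?V"]) auto
  have finI: "finite (I f)" for f using I(1) finite_subset by blast
  have finFs: "finite ?Fs" by (intro finite_PiE) auto
  have hit: "card (Hit f) * (2 ^ 64) ^ C \<le> 2 ^ card (pairs n) * (2 ^ 64 - 1) ^ C" for f
  proof -
    have "card (J f) = C" unfolding J_def C_def using n_subsets[OF finI, of f 2] I(2) by simp
    moreover have "finite (J f)" unfolding J_def using finI by (auto intro: finite_subset[of _ "Pow (I f)"])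
    moreover have "card (X f T) \<le> 64" if "T \<in> J f" for T
      unfolding X_def by (rule card_pairs_over) (use that I(3) in \<open>auto simp: J_def\<close>)
    ultimately show ?thesis
      using card_hitting[of "J f" "pairs n" "X f" 64] finP unfolding Hit_def X_def by auto
  qed
  have "?Bad \<subseteq> (\<Union>f\<in>?Fs. Hit f)"
  proof
    fix E assume "E \<in> ?Bad"
    then obtain f where E: "E \<subseteq> pairs n" and f: "clique_labelling (2 * r) \<lparr>verts = ?V, edges = E\<rparr> f" by blast
    \<comment> \<open>All deletion labels are merged into \<open>2 * r\<close>, which leaves only
      finitely many labellings to sum over.\<close>
    define g where "g = restrict (\<lambda>v. min (f v) (2 * r)) ?V"
    have g: "g v = f v" if "v \<in> fibre \<lparr>verts = ?V, edges = E\<rparr> f i" "i < 2 * r" for v i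
      using that by (auto simp: fibre_def g_def)
    have "E \<inter> X g T \<noteq> {}" if T: "T \<in> J g" for T
    proof -
      obtain i j where ij: "T = {i, j}" "i \<noteq> j" using T by (auto simp: J_def card_2_iff)
      then have lt: "i < 2 * r" "j < 2 * r" using T I(1)[of g] by (auto simp: J_def)
      obtain a b where ab: "a \<in> fibre \<lparr>verts = ?V, edges = E\<rparr> f i" "b \<in> fibre \<lparr>verts = ?V, edges = E\<rparr> f j" "{a, b} \<in> E"
        using clique_labelling_adjE[OF f lt ij(2)] by auto
      then have "g ` {a, b} = T" using g[OF ab(1) lt(1)] g[OF ab(2) lt(2)] ij by (auto simp: fibre_def)
      then show ?thesis using ab(3) E unfolding X_def by blast
    qed
    then have "E \<in> Hit g" using E unfolding Hit_def by blast
    moreover have "g \<in> ?Fs" by (auto simp: g_def)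
    ultimately show "E \<in> (\<Union>f\<in>?Fs. Hit f)" by blast
  qed
  moreover have "finite (Hit f)" for f
    unfolding Hit_def using finP by (auto intro: finite_subset[of _ "Pow (pairs n)"])
  ultimately have "card ?Bad \<le> (\<Sum>f\<in>?Fs. card (Hit f))"
    using card_mono[of "\<Union>f\<in>?Fs. Hit f" ?Bad] card_UN_le[OF finFs, of Hit] finFs by fastforce
  then have "card ?Bad * (2 ^ 64) ^ C \<le> (\<Sum>f\<in>?Fs. card (Hit f)) * (2 ^ 64) ^ C" by (rule mult_le_mono1)
  also have "\<dots> = (\<Sum>f\<in>?Fs. card (Hit f) * (2 ^ 64) ^ C)" by (rule sum_distrib_right)
  also have "\<dots> \<le> (\<Sum>f\<in>?Fs. 2 ^ card (pairs n) * (2 ^ 64 - 1) ^ C)" by (rule sum_mono) (rule hit)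
  also have "\<dots> = (2 * r + 1) ^ n * (2 ^ card (pairs n) * (2 ^ 64 - 1) ^ C)"
    by (simp add: card_PiE)
  finally show ?thesis .
qed

lemma dense_graph_without_clique_labelling:
  "\<exists>q (F :: nat ugraph). 2 \<le> q \<and> simple_graph F \<and> (\<nexists>f. clique_labelling q F f) \<and>
     (q - 2) * card (verts F) < card (edges F)"
proof -
  \<comment> \<open>\<open>k\<close> and \<open>r\<close> stay opaque: powers such as \<open>2 ^ r\<close> must not be evaluated.\<close>
  obtain k :: nat where k: "k = 80" by simp
  obtain r :: nat where r: "r = 2 ^ k" by simp
  define n where "n = 8 * r"
  define C where "C = r choose 2"
  \<comment> \<open>The failure probability must absorb the at most \<open>2^((k + 2) * n)\<close>
    labellings; the last 2 bits leave at most a quarter of all graphs bad.\<close>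
  define m where "m = (k + 2) * n + 2"
  let ?N = "card (pairs n)"
  let ?G = "\<lambda>E. \<lparr>verts = {..<n}, edges = E\<rparr>"
  let ?Bad = "{E. E \<subseteq> pairs n \<and> (\<exists>f. clique_labelling (2 * r) (?G E) f)}"
  let ?Sparse = "{E. E \<subseteq> pairs n \<and> 2 * card E < ?N}"
  have finP: "finite (pairs n)" by (rule finite_subset[of _ "Pow {..<n}"]) auto
  have finB: "finite ?Bad" and finS: "finite ?Sparse"
    by (rule finite_subset[OF _ finite_Pow_iff[THEN iffD2, OF finP]], blast)+
  \<comment> \<open>Here \<open>k = 80\<close> is used: the left side is about
    \<open>2^64 * 82 * 8 * r\<close>, below \<open>2^74 * r\<close>, while \<open>C\<close> is about
    \<open>r^2 / 2 = 2^79 * r\<close>.\<close>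
  have "2 ^ 64 * m \<le> C"
    unfolding C_def m_def n_def r k choose_two by simp
  then have "(2 ^ 64 - 1) ^ C * 2 ^ m \<le> (2 ^ 64 :: nat) ^ C" by (intro power_ratio_half) simp_all
  then have "card ?Bad * ((2 ^ 64 - 1) ^ C * 2 ^ m) \<le> card ?Bad * (2 ^ 64) ^ C" by (rule mult_le_mono2)
  also have "\<dots> \<le> (2 * r + 1) ^ n * (2 ^ ?N * (2 ^ 64 - 1) ^ C)"
    unfolding n_def C_def by (rule card_clique_labelled_graphs)
  finally have "(2 ^ 64 - 1) ^ C * (card ?Bad * 2 ^ m) \<le> (2 ^ 64 - 1) ^ C * ((2 * r + 1) ^ n * 2 ^ ?N)"
    by (simp only: ac_simps)
  moreover have "(0::nat) < (2 ^ 64 - 1) ^ C" by (rule zero_less_power) simp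
  ultimately have "card ?Bad * 2 ^ m \<le> (2 * r + 1) ^ n * 2 ^ ?N" using mult_le_cancel1 by blast
  also have "\<dots> \<le> (2 ^ (k + 2)) ^ n * 2 ^ ?N"
  proof (intro mult_le_mono1 power_mono)
    have "1 \<le> r" unfolding r by simp
    then show "2 * r + 1 \<le> 2 ^ (k + 2)" by (simp add: r)
  qed simp
  also have "\<dots> = 2 ^ ((k + 2) * n) * 2 ^ ?N" by (simp only: power_mult)
  finally have "2 ^ ((k + 2) * n) * (4 * card ?Bad) \<le> 2 ^ ((k + 2) * n) * 2 ^ ?N"
    unfolding m_def power_add by (simp add: ac_simps)
  moreover have "(0::nat) < 2 ^ ((k + 2) * n)" by (rule zero_less_power) simp
  ultimately have bad: "4 * card ?Bad \<le> 2 ^ ?N" using mult_le_cancel1 by blast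
  have "card (?Bad \<union> ?Sparse) \<le> card ?Bad + card ?Sparse" by (rule card_Un_le)
  moreover have "2 * card ?Sparse \<le> 2 ^ ?N" by (rule card_sparse_subsets[OF finP])
  moreover have "(0::nat) < 2 ^ ?N" by (rule zero_less_power) simp
  \<comment> \<open>A quarter bad and a half sparse still leave some graph over.\<close>
  ultimately have "card (?Bad \<union> ?Sparse) < 2 ^ ?N" using bad by linarith
  then have "card (?Bad \<union> ?Sparse) < card (Pow (pairs n))" by (simp only: card_Pow[OF finP])
  then have "\<not> Pow (pairs n) \<subseteq> ?Bad \<union> ?Sparse"
    using card_mono[OF finite_UnI[OF finB finS]] by (meson leD)
  then obtain E where "E \<subseteq> pairs n" "E \<notin> ?Bad" "E \<notin> ?Sparse" by blast
  then have E: "E \<subseteq> pairs n" "\<nexists>f. clique_labelling (2 * r) (?G E) f" "?N \<le> 2 * card E"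
    by (simp_all add: not_less)
  have "?N = n choose 2" using n_subsets[of "{..<n}" 2] by simp
  also have "\<dots> = 4 * r * (8 * r - 1)" unfolding n_def choose_two by simp
  finally have "4 * r * (8 * r - 1) \<le> 2 * card E" using E(3) by simp
  \<comment> \<open>The left side is \<open>4r(8r - 8)\<close>: the \<open>- 2\<close> in
    \<open>q - 2\<close> makes up for having \<open>n(n-1)/2\<close> pairs rather than
    \<open>n^2/2\<close>.\<close>
  moreover have "2 * ((2 * r - 2) * n) < 4 * r * (8 * r - 1)"
  proof -
    have "0 < r" by (simp add: r)
    then have "8 * r - 8 < 8 * r - 1" "0 < 4 * r" by linarith+
    then have "4 * r * (8 * r - 8) < 4 * r * (8 * r - 1)" by (simp only: mult_less_cancel1)
    then show ?thesis by (simp add: n_def algebra_simps)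
  qed
  ultimately have "(2 * r - 2) * card (verts (?G E)) < card (edges (?G E))" by (simp add: mult.commute)
  moreover have "simple_graph (?G E)" using E(1) by (auto simp: simple_graph_def)
  moreover have "2 \<le> 2 * r" by (simp add: r)
  ultimately show ?thesis using E(2) by blast
qed

section \<open>Hadwiger's bound\<close>

text \<open>\<open>q\<close> is fixed before \<open>p\<close> and \<open>K\<close>, so the surplus
  \<open>K\<close> may later depend on a graph built from \<open>q\<close>.\<close>

lemma exists_dense_graph_without_clique_labelling:
  "\<exists>q\<ge>2. \<forall>p K. \<exists>T :: nat ugraph. simple_graph T \<and> (\<nexists>f. clique_labelling (p + q) T f) \<and>
     (p + q - 2) * card (verts T) + K \<le> card (edges T)"
proof -
  obtain q and F :: "nat ugraph" where F: "2 \<le> q" "simple_graph F" "\<nexists>f. clique_labelling q F f"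
    "(q - 2) * card (verts F) < card (edges F)"
    using dense_graph_without_clique_labelling by blast
  have "\<exists>T :: nat ugraph. simple_graph T \<and> (\<nexists>f. clique_labelling (p + q) T f) \<and>
     (p + q - 2) * card (verts T) + K \<le> card (edges T)" for p K
  proof -
    define n where "n = card (verts F)"
    define s where "s = q - 2"
    \<comment> \<open>The edges from the cone vertices to the copies match the extra
      \<open>p\<close> in the coefficient. The copies' surplus of one edge each then pays for the
      \<open>p\<close> cone vertices and for \<open>K\<close>.\<close>
    define t where "t = (p + s) * p + K"
    have "0 < q" using F(1) by simp
    obtain C :: "nat ugraph" where C: "simple_graph C" "\<nexists>f. clique_labelling q C f"
      "card (verts C) = t * n" "card (edges C) = t * card (edges F)"
      using exists_copies[OF F(2) \<open>0 < q\<close> F(3), of t] unfolding n_def by blast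
    obtain T :: "nat ugraph" where T: "simple_graph T" "\<nexists>f. clique_labelling (q + p) T f"
      "card (verts T) = card (verts C) + p" "card (edges C) + p * card (verts C) \<le> card (edges T)"
      using exists_cones[OF C(1,2), of p] by blast
    have "(p + s) * card (verts T) + K = t * (s * n) + p * (t * n) + t"
      by (simp add: T(3) C(3) t_def algebra_simps)
    also have "\<dots> = t * (s * n + 1) + p * (t * n)" by simp
    also have "\<dots> \<le> t * card (edges F) + p * (t * n)"
      using F(4) by (intro add_le_mono1 mult_le_mono2) (simp add: s_def n_def)
    also have "\<dots> \<le> card (edges T)" using T(4) C(3,4) by simp
    finally have "(p + q - 2) * card (verts T) + K \<le> card (edges T)" using F(1) by (simp add: s_def)
    moreover have "\<nexists>f. clique_labelling (p + q) T f" using T(2) by (simp add: add.commute)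
    ultimately show ?thesis using T(1) by blast
  qed
  with F(1) show ?thesis by blast
qed

lemma hadwiger_bound:
  fixes p :: nat and G :: "'a ugraph"
  assumes hyp: "\<And>(q::nat) (H :: nat ugraph).
      1 \<le> q \<Longrightarrow> simple_graph H \<Longrightarrow>
      int (card (edges H)) \<ge> (int q - 2) * int (card (verts H)) - int ((q - 1) choose 2) + 1 \<Longrightarrow>
      minor (complete_graph q) H \<or> colorable (q - 1) H"
    and "1 \<le> p" "simple_graph G" "\<not> minor (complete_graph p) G"
  shows "colorable (p - 1) G"
proof -
  obtain q where q: "2 \<le> q" and dense: "\<And>K. \<exists>T :: nat ugraph. simple_graph T \<and>
      (\<nexists>f. clique_labelling (p + q) T f) \<and> (p + q - 2) * card (verts T) + K \<le> card (edges T)"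
    using exists_dense_graph_without_clique_labelling by metis
  have noG: "\<nexists>f. clique_labelling p G f" using assms(4) minor_of_clique_labelling[OF assms(3)] by blast
  obtain G' :: "nat ugraph" where G': "simple_graph G'" "\<nexists>f. clique_labelling (p + q) G' f"
    "\<And>c. colorable (c + q) G' \<Longrightarrow> colorable c G"
    using exists_cones[OF assms(3) noG, of q] by blast
  \<comment> \<open>The surplus pays for every vertex of \<open>G'\<close>, as if \<open>G'\<close>
    had no edges.\<close>
  obtain T :: "nat ugraph" where T: "simple_graph T" "\<nexists>f. clique_labelling (p + q) T f"
    "(p + q - 2) * card (verts T) + ((p + q - 2) * card (verts G') + 1) \<le> card (edges T)"
    using dense by blast
  obtain U :: "nat ugraph" where U: "simple_graph U" "\<nexists>f. clique_labelling (p + q) U f"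
    "card (verts U) = card (verts G') + card (verts T)" "card (edges U) = card (edges G') + card (edges T)"
    "\<And>c. colorable c U \<Longrightarrow> colorable c G'"
    using exists_disjoint_union[OF G'(1) T(1) _ G'(2) T(2)] assms(2) by auto
  have "(p + q - 2) * card (verts U) + 1 \<le> card (edges U)"
    using T(3) by (simp add: U(3,4) distrib_left)
  then have "int ((p + q - 2) * card (verts U) + 1) \<le> int (card (edges U))" by (simp only: of_nat_le_iff)
  then have "(int (p + q) - 2) * int (card (verts U)) + 1 \<le> int (card (edges U))"
    using q by (simp add: of_nat_diff)
  \<comment> \<open>Subtracting the binomial only lowers the threshold already met.\<close>
  then have "(int (p + q) - 2) * int (card (verts U)) - int ((p + q - 1) choose 2) + 1
      \<le> int (card (edges U))"
    by linarith
  then have "minor (complete_graph (p + q)) U \<or> colorable (p + q - 1) U"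
    using hyp[of "p + q" U] U(1) assms(2) by simp
  then have "colorable (p - 1 + q) U"
    using clique_labelling_of_minor[OF U(1)] U(2) assms(2) by auto
  then show ?thesis using U(5) G'(3) by blast
qed

theorem theorem5p2:
  fixes p :: nat and G :: "'a ugraph"
  assumes hyp: "\<And>(q::nat) (H :: nat ugraph).
      1 \<le> q \<Longrightarrow> simple_graph H \<Longrightarrow>
      int (card (edges H)) \<ge> (int q - 2) * int (card (verts H)) - int ((q - 1) choose 2) + 1 \<Longrightarrow>
      minor (complete_graph q) H \<or> colorable (q - 1) H"
    and "p \<ge> 5"
    and "simple_graph G"
    and "\<not> minor (complete_graph p) G"
  shows "colorable (2 * p - 6) G"
proof -
  have "colorable (p - 1) G"
    using hadwiger_bound[of p G] assms by simp
  moreover have "p - 1 \<le> 2 * p - 6" using \<open>p \<ge> 5\<close> by simp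
  ultimately show ?thesis unfolding colorable_def by (meson order_less_le_trans)
qed

end
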